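(* Let $1\le p,q,r\le\infty$ be such that $1+\frac1r=\frac1p+\frac1q$. Let $f\in L^q(\mathbb{R}^d)$ and let $G\colon\mathbb{R}^d\times\mathbb{R}^d\to\mathbb{R}$ be measurable such that, for some $\Gamma\ge 0$, $\|G(\cdot,y)\|_p\le\Gamma$ for all $y\in\mathbb{R}^d$ and $\|G(x,\cdot)\|_p\le\Gamma$ for all $x\in\mathbb{R}^d$. Then $$\|f\,\bar\ast\,G\|_r\le\|f\|_q\,\Gamma .$$
   Context: For measurable $f\colon\mathbb{R}^d\to\mathbb{R}$ and $G\colon\mathbb{R}^d\times\mathbb{R}^d\to\mathbb{R}$, the generalized convolution is $$(f\,\bar\ast\,G)(x):=\int_{\mathbb{R}^d} f(y)\,G(x,y)\,dy,$$ whenever the integral is well-defined. $\|\cdot\|_p$ denotes the norm of $L^p(\mathbb{R}^d)$ with respect to Lebesgue measure, and $1/\infty:=0$. *)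

theory Defs
  imports "HOL-Analysis.Analysis" "HOL-Probability.Essential_Supremum"
begin

text \<open>Norms take values in \<^typ>\<open>ennreal\<close>, so that they may be infinite, and the exponent is an
  extended nonnegative real as well; in \<^typ>\<open>ennreal\<close> the quotient \<open>1 / \<infinity>\<close> is \<open>0\<close>.
  As for the library's \<^const>\<open>esssup\<close>, the norm of a non-measurable function is infinite, so
  a finite bound on the norm includes measurability. Only exponents \<open>p \<ge> 1\<close> are meaningful.\<close>

definition Lp_norm :: "ennreal \<Rightarrow> 'a measure \<Rightarrow> ('a \<Rightarrow> real) \<Rightarrow> ennreal" where
  "Lp_norm p M f =
     (if f \<notin> borel_measurable M then \<infinity>
      else if p = \<infinity> then esssup M (\<lambda>x. ennreal \<bar>f x\<bar>)
      else let I = (\<integral>\<^sup>+ x. ennreal (\<bar>f x\<bar> powr enn2real p) \<partial>M)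
           in if I = \<infinity> then \<infinity> else ennreal (enn2real I powr (1 / enn2real p)))"

definition Lp_space :: "ennreal \<Rightarrow> 'a measure \<Rightarrow> ('a \<Rightarrow> real) set" where
  "Lp_space p M = {f \<in> borel_measurable M. Lp_norm p M f < \<infinity>}"

text \<open>The Bochner integral is \<open>0\<close> where the integrand is not integrable; statements about the
  convolution therefore have to assert integrability separately.\<close>

definition gen_conv :: "('a::euclidean_space \<Rightarrow> real) \<Rightarrow> ('a \<Rightarrow> 'a \<Rightarrow> real) \<Rightarrow> 'a \<Rightarrow> real" where
  "gen_conv f G x = (LINT y|lebesgue. f y * G x y)"

end

theory Submission
  imports Defs
begin

text \<open>Write \<open>h(x) = \<integral> f(y) G(x,y) dy\<close>. By homogeneity it is enough to treat \<open>\<parallel>f\<parallel>\<^sub>q \<le> 1\<close> and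
  \<open>\<Gamma> \<le> 1\<close>, and to show \<open>\<parallel>h\<parallel>\<^sub>r \<le> 1\<close>. If \<open>r = \<infinity>\<close>, the exponents \<open>p\<close> and \<open>q\<close> are conjugate and
  Hoelder's inequality for the section \<open>G(x,\<cdot>)\<close> bounds \<open>h(x)\<close> for every \<open>x\<close> (\<open>Hoelder_unit\<close>).

  If \<open>r < \<infinity>\<close>, all exponents are finite, and the idea is to bound \<open>\<bar>h(x)\<bar>\<^sup>r\<close> by a quantity that is
  linear in both \<open>\<bar>f\<bar>\<^sup>q\<close> and \<open>\<bar>G\<bar>\<^sup>p\<close>, namely by \<open>A(x) = \<integral> \<bar>f(y)\<bar>\<^sup>q \<bar>G(x,y)\<bar>\<^sup>p dy\<close>. The relation between
  the exponents says that \<open>1/r\<close>, \<open>1 - 1/p\<close> and \<open>1 - 1/q\<close> are nonnegative weights with sum \<open>1\<close>, and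
  that \<open>\<bar>f\<bar> \<bar>G\<bar>\<close> is the geometric mean with these weights of \<open>\<bar>f\<bar>\<^sup>q \<bar>G\<bar>\<^sup>p\<close>, \<open>\<bar>f\<bar>\<^sup>q\<close> and \<open>\<bar>G\<bar>\<^sup>p\<close>. Replacing it
  by the arithmetic mean, after dividing the first of the three by \<open>s\<^sup>r\<close>, and
  integrating in \<open>y\<close> gives \<open>\<integral> \<bar>f(y) G(x,y)\<bar> dy \<le> s\<close> whenever \<open>s\<^sup>r \<ge> A(x)\<close>, hence
  \<open>\<bar>h(x)\<bar>\<^sup>r \<le> A(x)\<close> (\<open>Young_section\<close>). This step uses the bound on \<open>G(x,\<cdot>)\<close>; the bound on \<open>G(\<cdot>,y)\<close>
  enters through Tonelli's theorem, which gives \<open>\<integral> A(x) dx \<le> 1\<close> (\<open>nn_integral_mixed_powr_le_1\<close>). In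
  particular \<open>A\<close> is finite almost everywhere, so that \<open>h\<close> is an honest integral almost everywhere.

  Since \<open>G\<close> is only Lebesgue measurable on the product, Tonelli's theorem for the product of the Borel
  measures has to be carried over to the completion: \<open>G\<close> agrees almost everywhere with a
  Borel function, and then almost all sections agree almost everywhere.\<close>

section \<open>Fubini's theorem for Lebesgue measurable functions on a product\<close>

text \<open>The preimages of a set under the two functions differ by a null set only, and in a complete
  measure space such a change preserves measurability.\<close>

lemma (in complete_measure) measurable_AE_cong:
  assumes g: "g \<in> M \<rightarrow>\<^sub>M N" and eq: "AE x in M. g x = f x"
    and f: "\<And>x. x \<in> space M \<Longrightarrow> f x \<in> space N"
  shows "f \<in> M \<rightarrow>\<^sub>M N"
proof (rule measurableI)
  fix A assume A: "A \<in> sets N"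
  show "f -` A \<inter> space M \<in> sets M"
  proof (rule in_sets_AE)
    show "AE x in M. x \<in> g -` A \<inter> space M \<longleftrightarrow> x \<in> f -` A \<inter> space M"
      using eq by eventually_elim auto
    show "g -` A \<inter> space M \<in> sets M"
      using g A by (rule measurable_sets)
  qed auto
qed (rule f)

text \<open>The Lebesgue measure on the product properly extends the product of the Lebesgue measures, but
  both come from the same Borel product measure, and completion does not alter what holds almost
  everywhere.\<close>

lemma lebesgue_AE_pair:
  fixes P :: "'a::euclidean_space \<times> 'b::euclidean_space \<Rightarrow> bool"
  assumes "AE z in lebesgue. P z"
  shows "AE x in lebesgue. AE y in lebesgue. P (x, y)"
    and "AE y in lebesgue. AE x in lebesgue. P (x, y)"
proof -
  have P: "AE z in lborel \<Otimes>\<^sub>M lborel. P z"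
    using assms unfolding lborel_prod by (simp add: AE_completion_iff)
  show "AE x in lebesgue. AE y in lebesgue. P (x, y)"
    using lborel_pair.AE_pair[OF P] by (simp add: AE_completion_iff)
  have "AE z in distr (lborel \<Otimes>\<^sub>M lborel) (lborel \<Otimes>\<^sub>M lborel) (\<lambda>(x :: 'b, y :: 'a). (y, x)). P z"
    using P by (subst (asm) lborel_pair.distr_pair_swap)
  then have "AE z in lborel \<Otimes>\<^sub>M (lborel :: 'a measure). P (snd z, fst z)"
    by (drule_tac AE_distrD[rotated]) (auto simp: case_prod_beta)
  from lborel_pair.AE_pair[OF this] show "AE y in lebesgue. AE x in lebesgue. P (x, y)"
    by (simp add: AE_completion_iff)
qed

text \<open>For the completed \<open>\<sigma>\<close>-algebra on the codomain, continuity alone is not enough: the preimage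
  of a null set has to be null, which holds because \<open>\<infinity> \<cdot> 0 = 0\<close> for product measures.\<close>

lemma measurable_lebesgue_snd:
  "snd \<in> (lebesgue :: ('a::euclidean_space \<times> 'b::euclidean_space) measure) \<rightarrow>\<^sub>M lebesgue"
proof (rule completion.measurable_completion2)
  have "snd \<in> (lborel :: ('a \<times> 'b) measure) \<rightarrow>\<^sub>M lborel"
    unfolding lborel_prod[symmetric] by (rule measurable_snd)
  then show snd: "snd \<in> (lebesgue :: ('a \<times> 'b) measure) \<rightarrow>\<^sub>M lborel"
    by (rule measurable_completion)
  show "null_sets lborel \<subseteq> null_sets (distr (lebesgue :: ('a \<times> 'b) measure) lborel snd)"
  proof
    fix N :: "'b set" assume N: "N \<in> null_sets lborel"
    then have sets: "N \<in> sets lborel" by auto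
    have "snd -` N \<inter> space (lebesgue :: ('a \<times> 'b) measure) = UNIV \<times> N"
      by auto
    moreover have "UNIV \<times> N \<in> sets (lborel \<Otimes>\<^sub>M lborel :: ('a \<times> 'b) measure)"
      using sets by (intro pair_measureI) auto
    then have "UNIV \<times> N \<in> sets (lborel :: ('a \<times> 'b) measure)"
      unfolding lborel_prod .
    moreover have "emeasure (lborel \<Otimes>\<^sub>M lborel :: ('a \<times> 'b) measure) (UNIV \<times> N) = 0"
      using N sets by (subst lborel.emeasure_pair_measure_Times) auto
    then have "emeasure (lborel :: ('a \<times> 'b) measure) (UNIV \<times> N) = 0"
      unfolding lborel_prod .
    ultimately show "N \<in> null_sets (distr (lebesgue :: ('a \<times> 'b) measure) lborel snd)"
      using sets snd by (simp add: null_sets_def emeasure_distr)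
  qed
qed

text \<open>A section of a Lebesgue measurable function need not be measurable. Replacing the function
  by an almost everywhere equal Borel function changes the integrals over the sections only on a null
  set of parameters, so exceptional sections do no harm.\<close>

lemma lebesgue_Tonelli:
  fixes H :: "'a::euclidean_space \<times> 'b::euclidean_space \<Rightarrow> ennreal"
  assumes "H \<in> borel_measurable lebesgue"
  shows "(\<lambda>x. \<integral>\<^sup>+ y. H (x, y) \<partial>lebesgue) \<in> borel_measurable lebesgue"
    and "(\<integral>\<^sup>+ x. \<integral>\<^sup>+ y. H (x, y) \<partial>lebesgue \<partial>lebesgue) = (\<integral>\<^sup>+ y. \<integral>\<^sup>+ x. H (x, y) \<partial>lebesgue \<partial>lebesgue)"
proof -
  obtain H' where H': "H' \<in> borel_measurable lborel" and eq: "AE z in lborel. H z = H' z"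
    using completion_ex_borel_measurable[OF assms] by auto
  have [measurable]: "H' \<in> borel_measurable (lborel \<Otimes>\<^sub>M lborel)"
    using H' unfolding lborel_prod .
  note sections = lebesgue_AE_pair[OF AE_completion[OF eq]]
  have 1: "AE x in lebesgue. (\<integral>\<^sup>+ y. H' (x, y) \<partial>lborel) = (\<integral>\<^sup>+ y. H (x, y) \<partial>lebesgue)"
    using sections(1)
  proof eventually_elim
    case (elim x)
    then show ?case
      unfolding nn_integral_completion
      by (intro nn_integral_cong_AE) (auto simp: AE_completion_iff eq_commute)
  qed
  have 2: "AE y in lebesgue. (\<integral>\<^sup>+ x. H' (x, y) \<partial>lborel) = (\<integral>\<^sup>+ x. H (x, y) \<partial>lebesgue)"
    using sections(2)
  proof eventually_elim
    case (elim y)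
    then show ?case
      unfolding nn_integral_completion
      by (intro nn_integral_cong_AE) (auto simp: AE_completion_iff eq_commute)
  qed
  have "(\<lambda>x. \<integral>\<^sup>+ y. H' (x, y) \<partial>lborel) \<in> borel_measurable (lborel :: 'a measure)"
    by measurable
  then show "(\<lambda>x. \<integral>\<^sup>+ y. H (x, y) \<partial>lebesgue) \<in> borel_measurable lebesgue"
    by (rule completion.measurable_AE_cong[OF measurable_completion 1]) auto
  have "(\<integral>\<^sup>+ x. \<integral>\<^sup>+ y. H (x, y) \<partial>lebesgue \<partial>lebesgue) = (\<integral>\<^sup>+ x. \<integral>\<^sup>+ y. H' (x, y) \<partial>lborel \<partial>lebesgue)"
    using 1 by (intro nn_integral_cong_AE) (auto simp: eq_commute)
  also have "\<dots> = (\<integral>\<^sup>+ y. \<integral>\<^sup>+ x. H' (x, y) \<partial>lborel \<partial>lebesgue)"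
    unfolding nn_integral_completion by (rule lborel_pair.Fubini[symmetric]) measurable
  also have "\<dots> = (\<integral>\<^sup>+ y. \<integral>\<^sup>+ x. H (x, y) \<partial>lebesgue \<partial>lebesgue)"
    using 2 by (intro nn_integral_cong_AE) auto
  finally show "(\<integral>\<^sup>+ x. \<integral>\<^sup>+ y. H (x, y) \<partial>lebesgue \<partial>lebesgue) = \<dots>" .
qed

lemma borel_measurable_lebesgue_integral_section:
  fixes H :: "'a::euclidean_space \<times> 'b::euclidean_space \<Rightarrow> real"
  assumes "H \<in> borel_measurable lebesgue"
  shows "(\<lambda>x. LINT y|lebesgue. H (x, y)) \<in> borel_measurable lebesgue"
proof -
  obtain H' where H': "H' \<in> borel_measurable lborel" and eq: "AE z in lborel. H z = H' z"
    using completion_ex_borel_measurable_real[OF assms] by auto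
  have [measurable]: "H' \<in> borel_measurable (lborel \<Otimes>\<^sub>M lborel)"
    using H' unfolding lborel_prod .
  have "AE x in lebesgue. AE y in lebesgue. H' (x, y) = H (x, y)"
    using lebesgue_AE_pair(1)[OF AE_completion[OF eq]] by (simp add: eq_commute)
  then have "AE x in lebesgue. (LINT y|lborel. H' (x, y)) = (LINT y|lebesgue. H (x, y))"
  proof eventually_elim
    case (elim x)
    have *: "(\<lambda>y. H' (x, y)) \<in> borel_measurable lborel"
      by measurable
    \<comment> \<open>Almost every section of \<open>H\<close> is measurable, by completeness.\<close>
    have "(\<lambda>y. H (x, y)) \<in> borel_measurable lebesgue"
      by (rule completion.measurable_AE_cong[OF measurable_completion[OF *] elim]) auto
    then have "(LINT y|lebesgue. H' (x, y)) = (LINT y|lebesgue. H (x, y))"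
      by (intro integral_cong_AE measurable_completion[OF *] elim)
    then show ?case
      by (simp add: integral_completion[OF *])
  qed
  moreover have "(\<lambda>x. LINT y|lborel. H' (x, y)) \<in> borel_measurable (lborel :: 'a measure)"
    by measurable
  ultimately show ?thesis
    by (intro completion.measurable_AE_cong[OF measurable_completion]) auto
qed

section \<open>The weighted inequality of arithmetic and geometric means\<close>

lemma weighted_AM_GM_3:
  fixes a b c x y z :: real
  assumes w: "0 \<le> a" "0 \<le> b" "0 \<le> c" "a + b + c = 1" and pos: "0 < x" "0 < y" "0 < z"
  shows "x powr a * y powr b * z powr c \<le> a * x + b * y + c * z"
proof -
  define m where "m = a * x + b * y + c * z"
  have m: "m > 0"
  proof -
    have "a > 0 \<or> b > 0 \<or> c > 0"
      using w by linarith
    then have "a * x > 0 \<or> b * y > 0 \<or> c * z > 0"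
      using pos by auto
    moreover have "a * x \<ge> 0" "b * y \<ge> 0" "c * z \<ge> 0"
      using w pos by auto
    ultimately show ?thesis
      unfolding m_def by linarith
  qed
  \<comment> \<open>the tangent to the logarithm at \<open>m\<close> lies above its graph\<close>
  have tangent: "ln t \<le> ln m + (t / m - 1)" if "t > 0" for t
    using ln_le_minus_one[of "t / m"] that m by (simp add: ln_div)
  have "a * ln x + b * ln y + c * ln z
      \<le> a * (ln m + (x / m - 1)) + b * (ln m + (y / m - 1)) + c * (ln m + (z / m - 1))"
    using w pos by (intro add_mono mult_left_mono tangent)
  also have "\<dots> = (a + b + c) * (ln m - 1) + (a * x + b * y + c * z) / m"
    by (simp add: algebra_simps add_divide_distrib)
  also have "\<dots> = ln m"
    using m w unfolding m_def[symmetric] by simp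
  finally have "exp (a * ln x + b * ln y + c * ln z) \<le> m"
    using m by (simp flip: ln_ge_iff)
  then show ?thesis
    using pos by (simp add: powr_def m_def exp_add)
qed

text \<open>Under the exponent relation the weights \<open>1/r\<close>, \<open>1 - 1/p\<close> and \<open>1 - 1/q\<close> sum to \<open>1\<close>, and with
  them the weighted geometric mean of \<open>u\<^sup>q v\<^sup>p / s\<^sup>r\<close>, \<open>u\<^sup>q\<close> and \<open>v\<^sup>p\<close> is exactly \<open>u v / s\<close>. The free
  parameter \<open>s\<close> makes up for the loss in passing to the arithmetic mean: it can be chosen after
  integration so that the three integrals balance.\<close>

lemma Young_pointwise:
  fixes u v p q r s :: real
  assumes p: "1 \<le> p" and q: "1 \<le> q" and r: "1 \<le> r" and pqr: "1 + 1 / r = 1 / p + 1 / q"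
    and nonneg: "0 \<le> u" "0 \<le> v" and s: "0 < s"
  shows "u * v \<le> s * (1 / r * ((u powr q * v powr p) / s powr r)
                        + (1 - 1 / p) * u powr q + (1 - 1 / q) * v powr p)"
proof (cases "u = 0 \<or> v = 0")
  case True
  have "0 \<le> s * (1 / r * ((u powr q * v powr p) / s powr r)
                  + (1 - 1 / p) * u powr q + (1 - 1 / q) * v powr p)"
    using p q r s by (intro mult_nonneg_nonneg add_nonneg_nonneg) auto
  with True show ?thesis by auto
next
  case False
  then have uv: "u > 0" "v > 0" using nonneg by auto
  \<comment> \<open>the total exponents of \<open>u\<close> and of \<open>v\<close> in the geometric mean\<close>
  have eu: "q / r + q * (1 - 1 / p) = 1" and ev: "p / r + p * (1 - 1 / q) = 1"
  proof -
    have "q / r + q * (1 - 1 / p) = q * ((1 + 1 / r) - 1 / p)"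
      by (simp add: algebra_simps)
    then show "q / r + q * (1 - 1 / p) = 1"
      unfolding pqr using q by simp
    have "p / r + p * (1 - 1 / q) = p * ((1 + 1 / r) - 1 / q)"
      by (simp add: algebra_simps)
    then show "p / r + p * (1 - 1 / q) = 1"
      unfolding pqr using p by simp
  qed
  have "((u powr q * v powr p) / s powr r) powr (1 / r)
          * (u powr q) powr (1 - 1 / p) * (v powr p) powr (1 - 1 / q)
      = (u powr (q / r) * u powr (q * (1 - 1 / p)))
          * (v powr (p / r) * v powr (p * (1 - 1 / q))) / s"
    using uv s r by (simp add: powr_divide powr_mult powr_powr)
  also have "\<dots> = u * v / s"
    unfolding powr_add[symmetric] eu ev using uv by simp
  finally have eq: "((u powr q * v powr p) / s powr r) powr (1 / r)
          * (u powr q) powr (1 - 1 / p) * (v powr p) powr (1 - 1 / q) = u * v / s" .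
  have "u * v / s \<le> 1 / r * ((u powr q * v powr p) / s powr r)
                  + (1 - 1 / p) * u powr q + (1 - 1 / q) * v powr p"
    unfolding eq[symmetric]
    using p q r pqr uv s by (intro weighted_AM_GM_3) (auto simp: algebra_simps)
  with s show ?thesis
    by (simp add: divide_le_eq mult.commute)
qed

section \<open>Bounds on the \<open>L\<^sup>p\<close> norm as bounds on integrals\<close>

lemma Lp_norm_top_le_iff:
  "Lp_norm \<infinity> M f \<le> ennreal c \<longleftrightarrow> f \<in> borel_measurable M \<and> (AE x in M. ennreal \<bar>f x\<bar> \<le> ennreal c)"
proof (cases "f \<in> borel_measurable M")
  case True
  then have *: "(\<lambda>x. ennreal \<bar>f x\<bar>) \<in> borel_measurable M"
    by measurable
  show ?thesis
  proof
    assume "Lp_norm \<infinity> M f \<le> ennreal c"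
    then have "esssup M (\<lambda>x. ennreal \<bar>f x\<bar>) \<le> ennreal c"
      using True by (simp add: Lp_norm_def)
    with esssup_AE[of "\<lambda>x. ennreal \<bar>f x\<bar>" M] have "AE x in M. ennreal \<bar>f x\<bar> \<le> ennreal c"
      by (auto elim!: eventually_mono)
    with True show "f \<in> borel_measurable M \<and> (AE x in M. ennreal \<bar>f x\<bar> \<le> ennreal c)" by simp
  next
    assume "f \<in> borel_measurable M \<and> (AE x in M. ennreal \<bar>f x\<bar> \<le> ennreal c)"
    with * show "Lp_norm \<infinity> M f \<le> ennreal c"
      by (auto simp: Lp_norm_def intro!: esssup_I)
  qed
qed (simp add: Lp_norm_def top_unique)

lemma Lp_norm_le_iff:
  assumes p: "1 \<le> p" and c: "0 \<le> c"
  shows "Lp_norm (ennreal p) M f \<le> ennreal c \<longleftrightarrow>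
    f \<in> borel_measurable M \<and> (\<integral>\<^sup>+ x. ennreal (\<bar>f x\<bar> powr p) \<partial>M) \<le> ennreal (c powr p)"
proof (cases "f \<in> borel_measurable M")
  case True
  define I where "I = (\<integral>\<^sup>+ x. ennreal (\<bar>f x\<bar> powr p) \<partial>M)"
  have norm: "Lp_norm (ennreal p) M f = (if I = \<infinity> then \<infinity> else ennreal (enn2real I powr (1 / p)))"
    using True p by (simp add: Lp_norm_def I_def Let_def)
  have "Lp_norm (ennreal p) M f \<le> ennreal c \<longleftrightarrow> I \<le> ennreal (c powr p)"
  proof (cases I)
    case (real i)
    have "i powr (1 / p) \<le> c \<longleftrightarrow> i \<le> c powr p"
    proof
      assume "i powr (1 / p) \<le> c"
      then have "(i powr (1 / p)) powr p \<le> c powr p"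
        using p by (intro powr_mono2) auto
      then show "i \<le> c powr p"
        using p real by (simp add: powr_powr)
    next
      assume "i \<le> c powr p"
      then have "i powr (1 / p) \<le> (c powr p) powr (1 / p)"
        using p real by (intro powr_mono2) auto
      then show "i powr (1 / p) \<le> c"
        using p c by (simp add: powr_powr)
    qed
    then show ?thesis
      unfolding norm using real c by simp
  qed (simp add: norm top_unique)
  with True show ?thesis
    by (simp add: I_def)
qed (simp add: Lp_norm_def top_unique)

lemma Lp_norm_cmult_le:
  assumes p: "1 \<le> p" and c: "0 \<le> c" and k: "0 \<le> k" and le: "Lp_norm p M f \<le> ennreal c"
  shows "Lp_norm p M (\<lambda>x. k * f x) \<le> ennreal (k * c)"
proof (cases p)
  case (real p')
  then have p': "1 \<le> p'"
    using p by simp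
  have f [measurable]: "f \<in> borel_measurable M"
    and I: "(\<integral>\<^sup>+ x. ennreal (\<bar>f x\<bar> powr p') \<partial>M) \<le> ennreal (c powr p')"
    using le Lp_norm_le_iff[OF p' c] real by auto
  have "(\<integral>\<^sup>+ x. ennreal (\<bar>k * f x\<bar> powr p') \<partial>M)
      = ennreal (k powr p') * (\<integral>\<^sup>+ x. ennreal (\<bar>f x\<bar> powr p') \<partial>M)"
    using k by (subst nn_integral_cmult[symmetric])
      (auto simp: abs_mult powr_mult ennreal_mult' intro!: nn_integral_cong)
  also have "\<dots> \<le> ennreal (k powr p') * ennreal (c powr p')"
    using I by (rule mult_left_mono) simp
  also have "\<dots> = ennreal ((k * c) powr p')"
    using k c by (simp add: powr_mult ennreal_mult')
  finally show ?thesis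
    using Lp_norm_le_iff[OF p', of "k * c" M "\<lambda>x. k * f x"] k c real by simp
next
  case top
  then have f: "f \<in> borel_measurable M" "AE x in M. ennreal \<bar>f x\<bar> \<le> ennreal c"
    using le Lp_norm_top_le_iff[of M f c] by auto
  from f(2) have "AE x in M. ennreal \<bar>k * f x\<bar> \<le> ennreal (k * c)"
    by eventually_elim (use k c in \<open>simp add: abs_mult mult_left_mono\<close>)
  with f(1) top show ?thesis
    using Lp_norm_top_le_iff[of M "\<lambda>x. k * f x" "k * c"] by simp
qed

section \<open>Estimates for a single section\<close>

text \<open>Normalized Hoelder inequality; exponents \<open>1\<close> and \<open>\<infinity>\<close> are included, which is what the case
  \<open>r = \<infinity>\<close> of the convolution inequality requires.\<close>

lemma Hoelder_unit:
  assumes p: "1 \<le> p" and q: "1 \<le> q" and pq: "1 / p + 1 / q = 1"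
    and f: "Lp_norm q M f \<le> 1" and g: "Lp_norm p M g \<le> 1"
  shows "(\<integral>\<^sup>+ y. ennreal \<bar>f y * g y\<bar> \<partial>M) \<le> 1"
proof -
  have [measurable]: "f \<in> borel_measurable M" "g \<in> borel_measurable M"
    using f g by (auto simp: Lp_norm_def top_unique split: if_splits)
  consider (p_top) "p = \<infinity>" "q = 1" | (q_top) "q = \<infinity>" "p = 1"
    | (finite) p' q' where "p = ennreal p'" "q = ennreal q'" "1 < p'" "1 < q'" "1 / p' + 1 / q' = 1"
  proof (cases p; cases q)
    fix p' q' assume real: "p = ennreal p'" "0 \<le> p'" "q = ennreal q'" "0 \<le> q'"
    then have ge: "1 \<le> p'" "1 \<le> q'" using p q by auto
    have "1 / p = ennreal (1 / p')" "1 / q = ennreal (1 / q')"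
      using real ge by (simp_all add: divide_ennreal flip: ennreal_1)
    then have "ennreal (1 / p' + 1 / q') = ennreal 1"
      using pq ge by (simp add: ennreal_plus)
    then have sum: "1 / p' + 1 / q' = 1"
      using ge by (subst (asm) ennreal_inj) auto
    moreover have "0 < 1 / p'" "0 < 1 / q'" using ge by auto
    ultimately have "1 / p' < 1" "1 / q' < 1" by linarith+
    then have "1 < p'" "1 < q'" using ge by (auto simp: divide_less_eq)
    with real sum show ?thesis by (intro finite)
  next
    fix p' assume real: "p = ennreal p'" "0 \<le> p'" "q = top"
    then have "1 \<le> p'" using p by simp
    moreover have "1 / p = ennreal (1 / p')"
      using real calculation by (simp add: divide_ennreal flip: ennreal_1)
    ultimately have "p' = 1"
      using pq real by simp
    with real show ?thesis by (intro q_top) auto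
  next
    fix q' assume real: "q = ennreal q'" "0 \<le> q'" "p = top"
    then have "1 \<le> q'" using q by simp
    moreover have "1 / q = ennreal (1 / q')"
      using real calculation by (simp add: divide_ennreal flip: ennreal_1)
    ultimately have "q' = 1"
      using pq real by simp
    with real show ?thesis by (intro p_top) auto
  next
    assume "p = top" "q = top"
    with pq show ?thesis by simp
  qed
  then show ?thesis
  proof cases
    case p_top
    have "AE y in M. ennreal \<bar>g y\<bar> \<le> 1"
      using g p_top Lp_norm_top_le_iff[of M g 1] by simp
    then have "AE y in M. ennreal \<bar>f y * g y\<bar> \<le> ennreal (\<bar>f y\<bar> powr 1)"
      by eventually_elim (simp add: abs_mult mult_left_le)
    then have "(\<integral>\<^sup>+ y. ennreal \<bar>f y * g y\<bar> \<partial>M) \<le> (\<integral>\<^sup>+ y. ennreal (\<bar>f y\<bar> powr 1) \<partial>M)"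
      by (rule nn_integral_mono_AE)
    also have "\<dots> \<le> 1"
      using f p_top Lp_norm_le_iff[of 1 1 M f] by simp
    finally show ?thesis .
  next
    case q_top
    have "AE y in M. ennreal \<bar>f y\<bar> \<le> 1"
      using f q_top Lp_norm_top_le_iff[of M f 1] by simp
    then have "AE y in M. ennreal \<bar>f y * g y\<bar> \<le> ennreal (\<bar>g y\<bar> powr 1)"
      by eventually_elim (simp add: abs_mult mult_left_le_one_le)
    then have "(\<integral>\<^sup>+ y. ennreal \<bar>f y * g y\<bar> \<partial>M) \<le> (\<integral>\<^sup>+ y. ennreal (\<bar>g y\<bar> powr 1) \<partial>M)"
      by (rule nn_integral_mono_AE)
    also have "\<dots> \<le> 1"
      using g q_top Lp_norm_le_iff[of 1 1 M g] by simp
    finally show ?thesis .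
  next
    case finite
    have "ennreal \<bar>f y * g y\<bar>
        \<le> ennreal (1 / q') * ennreal (\<bar>f y\<bar> powr q') + ennreal (1 / p') * ennreal (\<bar>g y\<bar> powr p')" for y
    proof -
      have "\<bar>f y * g y\<bar> \<le> 1 / q' * \<bar>f y\<bar> powr q' + 1 / p' * \<bar>g y\<bar> powr p'"
        using Youngs_inequality[of q' p' "\<bar>f y\<bar>" "\<bar>g y\<bar>"] finite by (simp add: abs_mult add.commute)
      then have "ennreal \<bar>f y * g y\<bar> \<le> ennreal (1 / q' * \<bar>f y\<bar> powr q' + 1 / p' * \<bar>g y\<bar> powr p')"
        by (rule ennreal_leI)
      with finite show ?thesis by (simp add: ennreal_plus flip: ennreal_mult)
    qed
    then have "(\<integral>\<^sup>+ y. ennreal \<bar>f y * g y\<bar> \<partial>M)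
        \<le> (\<integral>\<^sup>+ y. ennreal (1 / q') * ennreal (\<bar>f y\<bar> powr q') + ennreal (1 / p') * ennreal (\<bar>g y\<bar> powr p') \<partial>M)"
      by (intro nn_integral_mono)
    also have "\<dots> = ennreal (1 / q') * (\<integral>\<^sup>+ y. ennreal (\<bar>f y\<bar> powr q') \<partial>M)
                 + ennreal (1 / p') * (\<integral>\<^sup>+ y. ennreal (\<bar>g y\<bar> powr p') \<partial>M)"
      by (simp add: nn_integral_add nn_integral_cmult)
    also have "\<dots> \<le> ennreal (1 / q') * 1 + ennreal (1 / p') * 1"
      using f g finite Lp_norm_le_iff[of q' 1 M f] Lp_norm_le_iff[of p' 1 M g]
      by (intro add_mono mult_left_mono) auto
    also have "\<dots> = ennreal (1 / p' + 1 / q')"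
      using finite(3,4) by (simp add: ennreal_plus add.commute)
    also have "\<dots> = 1"
      by (simp only: finite ennreal_1)
    finally show ?thesis .
  qed
qed

text \<open>Integrating the pointwise inequality bounds each of the three terms by its own weight times
  \<open>s\<close>, and the weights sum to \<open>1\<close>.\<close>

lemma Young_section_scaled:
  fixes p q r s :: real
  assumes p: "1 \<le> p" and q: "1 \<le> q" and r: "1 \<le> r" and pqr: "1 + 1 / r = 1 / p + 1 / q"
    and [measurable]: "f \<in> borel_measurable M" "g \<in> borel_measurable M"
    and f: "(\<integral>\<^sup>+ y. ennreal (\<bar>f y\<bar> powr q) \<partial>M) \<le> 1"
    and g: "(\<integral>\<^sup>+ y. ennreal (\<bar>g y\<bar> powr p) \<partial>M) \<le> 1"
    and s: "0 < s"
    and A: "(\<integral>\<^sup>+ y. ennreal (\<bar>f y\<bar> powr q * \<bar>g y\<bar> powr p) \<partial>M) \<le> ennreal (s powr r)"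
  shows "(\<integral>\<^sup>+ y. ennreal \<bar>f y * g y\<bar> \<partial>M) \<le> ennreal s"
proof -
  define a where "a = s / (r * s powr r)"
  define b where "b = s * (1 - 1 / p)"
  define c where "c = s * (1 - 1 / q)"
  have nonneg: "0 \<le> a" "0 \<le> b" "0 \<le> c"
    using p q r s by (auto simp: a_def b_def c_def)
  have "ennreal \<bar>f y * g y\<bar> \<le> ennreal a * ennreal (\<bar>f y\<bar> powr q * \<bar>g y\<bar> powr p)
          + ennreal b * ennreal (\<bar>f y\<bar> powr q) + ennreal c * ennreal (\<bar>g y\<bar> powr p)" for y
  proof -
    have "\<bar>f y * g y\<bar> \<le> a * (\<bar>f y\<bar> powr q * \<bar>g y\<bar> powr p) + b * \<bar>f y\<bar> powr q + c * \<bar>g y\<bar> powr p"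
      using Young_pointwise[OF p q r pqr abs_ge_zero abs_ge_zero s, of "f y" "g y"]
      by (simp add: abs_mult a_def b_def c_def distrib_left mult.assoc)
    then have "ennreal \<bar>f y * g y\<bar>
        \<le> ennreal (a * (\<bar>f y\<bar> powr q * \<bar>g y\<bar> powr p) + b * \<bar>f y\<bar> powr q + c * \<bar>g y\<bar> powr p)"
      by (rule ennreal_leI)
    with nonneg show ?thesis by (simp add: ennreal_plus ennreal_mult)
  qed
  then have "(\<integral>\<^sup>+ y. ennreal \<bar>f y * g y\<bar> \<partial>M)
      \<le> (\<integral>\<^sup>+ y. ennreal a * ennreal (\<bar>f y\<bar> powr q * \<bar>g y\<bar> powr p)
          + ennreal b * ennreal (\<bar>f y\<bar> powr q) + ennreal c * ennreal (\<bar>g y\<bar> powr p) \<partial>M)"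
    by (intro nn_integral_mono)
  also have "\<dots> = ennreal a * (\<integral>\<^sup>+ y. ennreal (\<bar>f y\<bar> powr q * \<bar>g y\<bar> powr p) \<partial>M)
      + ennreal b * (\<integral>\<^sup>+ y. ennreal (\<bar>f y\<bar> powr q) \<partial>M)
      + ennreal c * (\<integral>\<^sup>+ y. ennreal (\<bar>g y\<bar> powr p) \<partial>M)"
    by (simp add: nn_integral_add nn_integral_cmult)
  also have "\<dots> \<le> ennreal a * ennreal (s powr r) + ennreal b * 1 + ennreal c * 1"
    using f g A by (intro add_mono mult_left_mono) auto
  also have "\<dots> = ennreal (a * s powr r + b + c)"
    using nonneg by (simp add: ennreal_plus ennreal_mult)
  also have "a * s powr r + b + c = s * (1 / r + (1 - 1 / p) + (1 - 1 / q))"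
    using r s by (simp add: a_def b_def c_def algebra_simps)
  also have "1 / r + (1 - 1 / p) + (1 - 1 / q) = 1"
    using pqr by linarith
  finally show ?thesis
    by simp
qed

text \<open>The optimal parameter is \<open>s = A\<^sup>1\<^sup>/\<^sup>r\<close>, which is not admissible if \<open>A = 0\<close>. Approaching it from
  above treats all cases alike.\<close>

lemma Young_section:
  fixes p q r :: real
  assumes p: "1 \<le> p" and q: "1 \<le> q" and r: "1 \<le> r" and pqr: "1 + 1 / r = 1 / p + 1 / q"
    and f_meas: "f \<in> borel_measurable M" and g_meas: "g \<in> borel_measurable M"
    and f: "(\<integral>\<^sup>+ y. ennreal (\<bar>f y\<bar> powr q) \<partial>M) \<le> 1"
    and g: "(\<integral>\<^sup>+ y. ennreal (\<bar>g y\<bar> powr p) \<partial>M) \<le> 1"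
  defines "A \<equiv> \<integral>\<^sup>+ y. ennreal (\<bar>f y\<bar> powr q * \<bar>g y\<bar> powr p) \<partial>M"
  assumes A: "A < \<infinity>"
  shows "integrable M (\<lambda>y. f y * g y)"
    and "ennreal (\<bar>LINT y|M. f y * g y\<bar> powr r) \<le> A"
proof -
  obtain a where a: "A = ennreal a" "0 \<le> a"
    using A by (cases A) auto
  have bound: "(\<integral>\<^sup>+ y. ennreal \<bar>f y * g y\<bar> \<partial>M) \<le> ennreal s" if "a powr (1 / r) < s" for s
  proof (rule Young_section_scaled[OF p q r pqr f_meas g_meas f g])
    show "0 < s"
      using that powr_ge_zero[of a "1 / r"] by linarith
    have "(a powr (1 / r)) powr r \<le> s powr r"
      using that r by (intro powr_mono2) auto
    then show "(\<integral>\<^sup>+ y. ennreal (\<bar>f y\<bar> powr q * \<bar>g y\<bar> powr p) \<partial>M) \<le> ennreal (s powr r)"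
      using a r by (simp add: A_def powr_powr ennreal_leI)
  qed
  have "(\<integral>\<^sup>+ y. ennreal (norm (f y * g y)) \<partial>M) < \<infinity>"
    using bound[of "a powr (1 / r) + 1"] by (auto simp: le_less_trans)
  then show int: "integrable M (\<lambda>y. f y * g y)"
    using f_meas g_meas by (intro integrableI_bounded) auto
  have "\<bar>LINT y|M. f y * g y\<bar> \<le> s" if "a powr (1 / r) < s" for s
  proof -
    have "ennreal \<bar>LINT y|M. f y * g y\<bar> \<le> (\<integral>\<^sup>+ y. ennreal \<bar>f y * g y\<bar> \<partial>M)"
      using integral_norm_bound_ennreal[OF int] by simp
    also have "\<dots> \<le> ennreal s"
      using that by (rule bound)
    finally show ?thesis
      using that powr_ge_zero[of a "1 / r"] by (subst (asm) ennreal_le_iff) linarith+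
  qed
  then have "\<bar>LINT y|M. f y * g y\<bar> \<le> a powr (1 / r)"
    by (rule dense_ge)
  then have "\<bar>LINT y|M. f y * g y\<bar> powr r \<le> (a powr (1 / r)) powr r"
    using r by (intro powr_mono2) auto
  then show "ennreal (\<bar>LINT y|M. f y * g y\<bar> powr r) \<le> A"
    using a r by (simp add: powr_powr ennreal_leI)
qed

section \<open>Young's inequality for generalized convolutions\<close>

lemma borel_measurable_gen_conv:
  fixes f :: "'a::euclidean_space \<Rightarrow> real"
  assumes f: "f \<in> borel_measurable lebesgue" and G: "(\<lambda>(x, y). G x y) \<in> borel_measurable lebesgue"
  shows "gen_conv f G \<in> borel_measurable lebesgue"
proof -
  have "(\<lambda>z :: 'a \<times> 'a. f (snd z)) \<in> borel_measurable lebesgue"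
    using measurable_compose[OF measurable_lebesgue_snd f] .
  with G have "(\<lambda>z. f (snd z) * (case z of (x, y) \<Rightarrow> G x y)) \<in> borel_measurable lebesgue"
    by (rule borel_measurable_times[rotated])
  from borel_measurable_lebesgue_integral_section[OF this] show ?thesis
    by (simp add: gen_conv_def[abs_def])
qed

text \<open>Exchanging the order of integration lets the inner integral run over the first argument of
  \<open>G\<close>, where the bound on \<open>G(\<cdot>,y)\<close> applies.\<close>

lemma nn_integral_mixed_powr_le_1:
  fixes f :: "'a::euclidean_space \<Rightarrow> real" and G :: "'a \<Rightarrow> 'a \<Rightarrow> real"
  assumes f: "f \<in> borel_measurable lebesgue" and G: "(\<lambda>(x, y). G x y) \<in> borel_measurable lebesgue"
    and f_le: "(\<integral>\<^sup>+ y. ennreal (\<bar>f y\<bar> powr q) \<partial>lebesgue) \<le> 1"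
    and G_meas: "\<And>y. (\<lambda>x. G x y) \<in> borel_measurable lebesgue"
    and G_le: "\<And>y. (\<integral>\<^sup>+ x. ennreal (\<bar>G x y\<bar> powr p) \<partial>lebesgue) \<le> 1"
  defines "A \<equiv> \<lambda>x. \<integral>\<^sup>+ y. ennreal (\<bar>f y\<bar> powr q * \<bar>G x y\<bar> powr p) \<partial>lebesgue"
  shows "A \<in> borel_measurable lebesgue" and "(\<integral>\<^sup>+ x. A x \<partial>lebesgue) \<le> 1"
proof -
  define H where "H z = ennreal (\<bar>f (snd z)\<bar> powr q * \<bar>case z of (x, y) \<Rightarrow> G x y\<bar> powr p)"
    for z :: "'a \<times> 'a"
  have [measurable]: "(\<lambda>z :: 'a \<times> 'a. f (snd z)) \<in> borel_measurable lebesgue"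
    using measurable_compose[OF measurable_lebesgue_snd f] .
  have H: "H \<in> borel_measurable lebesgue"
    unfolding H_def[abs_def] using G by measurable
  show "A \<in> borel_measurable lebesgue"
    using lebesgue_Tonelli(1)[OF H] by (simp add: A_def H_def)
  have "(\<integral>\<^sup>+ x. A x \<partial>lebesgue)
      = (\<integral>\<^sup>+ y. \<integral>\<^sup>+ x. ennreal (\<bar>f y\<bar> powr q) * ennreal (\<bar>G x y\<bar> powr p) \<partial>lebesgue \<partial>lebesgue)"
    using lebesgue_Tonelli(2)[OF H] by (simp add: A_def H_def ennreal_mult)
  also have "\<dots> = (\<integral>\<^sup>+ y. ennreal (\<bar>f y\<bar> powr q) * (\<integral>\<^sup>+ x. ennreal (\<bar>G x y\<bar> powr p) \<partial>lebesgue) \<partial>lebesgue)"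
    using G_meas by (intro nn_integral_cong nn_integral_cmult) measurable
  also have "\<dots> \<le> (\<integral>\<^sup>+ y. ennreal (\<bar>f y\<bar> powr q) * 1 \<partial>lebesgue)"
    by (intro nn_integral_mono mult_left_mono G_le) auto
  also have "\<dots> \<le> 1"
    using f_le by simp
  finally show "(\<integral>\<^sup>+ x. A x \<partial>lebesgue) \<le> 1" .
qed

lemma Young_gen_conv_unit:
  fixes p q r :: ennreal and f :: "'a::euclidean_space \<Rightarrow> real"
  assumes p: "1 \<le> p" and q: "1 \<le> q" and r: "1 \<le> r" and pqr: "1 + 1 / r = 1 / p + 1 / q"
    and f: "Lp_norm q lebesgue f \<le> 1"
    and G: "(\<lambda>(x, y). G x y) \<in> borel_measurable lebesgue"
    and G1: "\<And>y. Lp_norm p lebesgue (\<lambda>x. G x y) \<le> 1"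
    and G2: "\<And>x. Lp_norm p lebesgue (\<lambda>y. G x y) \<le> 1"
  shows "AE x in lebesgue. integrable lebesgue (\<lambda>y. f y * G x y)"
    and "Lp_norm r lebesgue (gen_conv f G) \<le> 1"
proof -
  have f_meas: "f \<in> borel_measurable lebesgue"
    using f by (auto simp: Lp_norm_def top_unique split: if_splits)
  have G1_meas: "(\<lambda>x. G x y) \<in> borel_measurable lebesgue" for y
    using G1[of y] by (auto simp: Lp_norm_def top_unique split: if_splits)
  have G2_meas: "(\<lambda>y. G x y) \<in> borel_measurable lebesgue" for x
    using G2[of x] by (auto simp: Lp_norm_def top_unique split: if_splits)
  have conv_meas: "gen_conv f G \<in> borel_measurable lebesgue"
    using f_meas G by (rule borel_measurable_gen_conv)
  have "(AE x in lebesgue. integrable lebesgue (\<lambda>y. f y * G x y))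
      \<and> Lp_norm r lebesgue (gen_conv f G) \<le> 1"
  proof (cases r)
    case top
    then have pq: "1 / p + 1 / q = 1"
      using pqr by simp
    have bound: "(\<integral>\<^sup>+ y. ennreal \<bar>f y * G x y\<bar> \<partial>lebesgue) \<le> 1" for x
      using p q pq f G2 by (rule Hoelder_unit)
    have int: "integrable lebesgue (\<lambda>y. f y * G x y)" for x
    proof (rule integrableI_bounded)
      show "(\<integral>\<^sup>+ y. ennreal (norm (f y * G x y)) \<partial>lebesgue) < \<infinity>"
        using bound[of x] by (auto simp: le_less_trans)
    qed (use f_meas G2_meas in measurable)
    have "ennreal \<bar>gen_conv f G x\<bar> \<le> 1" for x
      using order_trans[OF integral_norm_bound_ennreal[OF int[of x]], of 1] bound[of x]
      by (simp add: gen_conv_def)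
    then have "Lp_norm r lebesgue (gen_conv f G) \<le> 1"
      using conv_meas top Lp_norm_top_le_iff[of lebesgue "gen_conv f G" 1] by simp
    with int show ?thesis by simp
  next
    case r': (real r')
    then have r'_ge: "1 \<le> r'" using r by simp
    have inv_r: "1 / r = ennreal (1 / r')"
      using r' r'_ge by (simp add: divide_ennreal flip: ennreal_1)
    have inv_le_1: "1 / t \<le> 1" if "1 \<le> t" for t :: ennreal
      using that by (cases t) (auto simp: divide_ennreal simp flip: ennreal_1)
    \<comment> \<open>if \<open>p\<close> or \<open>q\<close> were infinite, the right-hand side of the exponent relation would be at most \<open>1\<close>.\<close>
    have gt_1: "1 < 1 + 1 / r"
      using r'_ge unfolding inv_r by (simp add: ennreal_less_iff flip: ennreal_1 ennreal_plus)
    have "p \<noteq> \<infinity>" "q \<noteq> \<infinity>"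
      using gt_1 inv_le_1[OF p] inv_le_1[OF q] unfolding pqr by auto
    then obtain p' q' where pq': "p = ennreal p'" "q = ennreal q'" "0 \<le> p'" "0 \<le> q'"
      by (cases p; cases q) auto
    then have ge: "1 \<le> p'" "1 \<le> q'" using p q by auto
    have "1 / p = ennreal (1 / p')" "1 / q = ennreal (1 / q')"
      using pq' ge by (simp_all add: divide_ennreal flip: ennreal_1)
    then have "ennreal (1 + 1 / r') = ennreal (1 / p' + 1 / q')"
      using pqr inv_r ge r'_ge by (simp add: ennreal_plus)
    then have pqr': "1 + 1 / r' = 1 / p' + 1 / q'"
      using ge r'_ge by (subst (asm) ennreal_inj) auto
    have f_le: "(\<integral>\<^sup>+ y. ennreal (\<bar>f y\<bar> powr q') \<partial>lebesgue) \<le> 1"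
      using f pq' ge Lp_norm_le_iff[of q' 1 lebesgue f] by simp
    have G1_le: "(\<integral>\<^sup>+ x. ennreal (\<bar>G x y\<bar> powr p') \<partial>lebesgue) \<le> 1" for y
      using G1[of y] pq' ge Lp_norm_le_iff[of p' 1 lebesgue "\<lambda>x. G x y"] by simp
    have G2_le: "(\<integral>\<^sup>+ y. ennreal (\<bar>G x y\<bar> powr p') \<partial>lebesgue) \<le> 1" for x
      using G2[of x] pq' ge Lp_norm_le_iff[of p' 1 lebesgue "\<lambda>y. G x y"] by simp
    define A where "A x = (\<integral>\<^sup>+ y. ennreal (\<bar>f y\<bar> powr q' * \<bar>G x y\<bar> powr p') \<partial>lebesgue)" for x
    have A_meas: "A \<in> borel_measurable lebesgue" and A_le: "(\<integral>\<^sup>+ x. A x \<partial>lebesgue) \<le> 1"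
      using nn_integral_mixed_powr_le_1[OF f_meas G f_le G1_meas G1_le]
      unfolding A_def[abs_def] by auto
    have "AE x in lebesgue. A x \<noteq> \<infinity>"
      using A_meas A_le by (intro nn_integral_PInf_AE) (auto simp: top_unique)
    then have "AE x in lebesgue. integrable lebesgue (\<lambda>y. f y * G x y)
        \<and> ennreal (\<bar>gen_conv f G x\<bar> powr r') \<le> A x"
    proof eventually_elim
      case (elim x)
      then have "(\<integral>\<^sup>+ y. ennreal (\<bar>f y\<bar> powr q' * \<bar>G x y\<bar> powr p') \<partial>lebesgue) < \<infinity>"
        by (simp add: A_def less_top)
      from Young_section[OF ge r'_ge pqr' f_meas G2_meas f_le G2_le this] show ?case
        by (simp add: gen_conv_def A_def)
    qed
    then have int: "AE x in lebesgue. integrable lebesgue (\<lambda>y. f y * G x y)"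
      and le_A: "AE x in lebesgue. ennreal (\<bar>gen_conv f G x\<bar> powr r') \<le> A x"
      by (auto elim: eventually_mono)
    have "(\<integral>\<^sup>+ x. ennreal (\<bar>gen_conv f G x\<bar> powr r') \<partial>lebesgue) \<le> 1"
      using nn_integral_mono_AE[OF le_A] A_le by (rule order_trans)
    then have "Lp_norm r lebesgue (gen_conv f G) \<le> 1"
      using r' r'_ge conv_meas Lp_norm_le_iff[of r' 1 lebesgue "gen_conv f G"] by simp
    with int show ?thesis by simp
  qed
  then show "AE x in lebesgue. integrable lebesgue (\<lambda>y. f y * G x y)"
    and "Lp_norm r lebesgue (gen_conv f G) \<le> 1"
    by auto
qed

lemma Young_gen_conv_scaled:
  fixes p q r :: ennreal and f :: "'a::euclidean_space \<Rightarrow> real" and \<alpha> \<gamma> :: real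
  assumes p: "1 \<le> p" and q: "1 \<le> q" and r: "1 \<le> r" and pqr: "1 + 1 / r = 1 / p + 1 / q"
    and pos: "0 < \<alpha>" "0 < \<gamma>"
    and f: "Lp_norm q lebesgue f \<le> ennreal \<alpha>"
    and G: "(\<lambda>(x, y). G x y) \<in> borel_measurable lebesgue"
    and G1: "\<And>y. Lp_norm p lebesgue (\<lambda>x. G x y) \<le> ennreal \<gamma>"
    and G2: "\<And>x. Lp_norm p lebesgue (\<lambda>y. G x y) \<le> ennreal \<gamma>"
  shows "AE x in lebesgue. integrable lebesgue (\<lambda>y. f y * G x y)"
    and "Lp_norm r lebesgue (gen_conv f G) \<le> ennreal (\<alpha> * \<gamma>)"
proof -
  define f' where "f' y = inverse \<alpha> * f y" for y
  define G' where "G' x y = inverse \<gamma> * G x y" for x y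
  have prod: "f y * G x y = (\<alpha> * \<gamma>) * (f' y * G' x y)" for x y
    using pos by (simp add: f'_def G'_def field_simps)
  have f': "Lp_norm q lebesgue f' \<le> 1"
    using Lp_norm_cmult_le[OF q _ _ f, of "inverse \<alpha>"] pos by (simp add: f'_def[abs_def])
  have G'1: "Lp_norm p lebesgue (\<lambda>x. G' x y) \<le> 1" for y
    using Lp_norm_cmult_le[OF p _ _ G1[of y], of "inverse \<gamma>"] pos by (simp add: G'_def[abs_def])
  have G'2: "Lp_norm p lebesgue (\<lambda>y. G' x y) \<le> 1" for x
    using Lp_norm_cmult_le[OF p _ _ G2[of x], of "inverse \<gamma>"] pos by (simp add: G'_def[abs_def])
  have G': "(\<lambda>(x, y). G' x y) \<in> borel_measurable lebesgue"
    using borel_measurable_times[OF borel_measurable_const G, of "inverse \<gamma>"]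
    by (simp add: G'_def case_prod_beta)
  note unit = Young_gen_conv_unit[OF p q r pqr f' G' G'1 G'2]
  show "AE x in lebesgue. integrable lebesgue (\<lambda>y. f y * G x y)"
    using unit(1) unfolding prod by eventually_elim simp
  have "gen_conv f G = (\<lambda>x. (\<alpha> * \<gamma>) * gen_conv f' G' x)"
    unfolding gen_conv_def prod by (rule ext) (rule integral_mult_right_zero)
  then show "Lp_norm r lebesgue (gen_conv f G) \<le> ennreal (\<alpha> * \<gamma>)"
    using Lp_norm_cmult_le[OF r, of 1 "\<alpha> * \<gamma>" lebesgue "gen_conv f' G'"] unit(2) pos by simp
qed

theorem theorem7:
  fixes p q r :: ennreal
    and f :: "real ^ 'd \<Rightarrow> real"
    and G :: "real ^ 'd \<Rightarrow> real ^ 'd \<Rightarrow> real"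
    and \<Gamma> :: real
  assumes "1 \<le> p" and "1 \<le> q" and "1 \<le> r"
    and "1 + 1 / r = 1 / p + 1 / q"
    and "f \<in> Lp_space q lebesgue"
    and "(\<lambda>(x, y). G x y) \<in> borel_measurable lebesgue"
    and "0 \<le> \<Gamma>"
    and "\<And>y. Lp_norm p lebesgue (\<lambda>x. G x y) \<le> ennreal \<Gamma>"
    and "\<And>x. Lp_norm p lebesgue (\<lambda>y. G x y) \<le> ennreal \<Gamma>"
  shows "(AE x in lebesgue. integrable lebesgue (\<lambda>y. f y * G x y)) \<and>
         gen_conv f G \<in> borel_measurable lebesgue \<and>
         Lp_norm r lebesgue (gen_conv f G) \<le> Lp_norm q lebesgue f * ennreal \<Gamma>"
proof -
  have f_meas: "f \<in> borel_measurable lebesgue" and f_fin: "Lp_norm q lebesgue f < \<infinity>"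
    using assms(5) by (auto simp: Lp_space_def)
  obtain a where a: "Lp_norm q lebesgue f = ennreal a" "0 \<le> a"
    using f_fin by (cases "Lp_norm q lebesgue f") auto
  \<comment> \<open>Normalizing divides by the norms, which may vanish; enlarging both by \<open>e\<close> avoids this, and
    \<open>e \<rightarrow> 0\<close> recovers the sharp bound.\<close>
  have scaled: "(AE x in lebesgue. integrable lebesgue (\<lambda>y. f y * G x y))
      \<and> Lp_norm r lebesgue (gen_conv f G) \<le> ennreal ((a + e) * (\<Gamma> + e))" if "0 < e" for e
  proof -
    have le: "ennreal \<Gamma> \<le> ennreal (\<Gamma> + e)" "Lp_norm q lebesgue f \<le> ennreal (a + e)"
      using that a by (auto intro: ennreal_leI)
    have pos: "0 < a + e" "0 < \<Gamma> + e"
      using that a assms(7) by auto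
    show ?thesis
      using Young_gen_conv_scaled[OF assms(1-4) pos le(2) assms(6)
          order_trans[OF assms(8) le(1)] order_trans[OF assms(9) le(1)]] by simp
  qed
  have "((\<lambda>e. ennreal ((a + e) * (\<Gamma> + e))) \<longlongrightarrow> ennreal ((a + 0) * (\<Gamma> + 0))) (at_right 0)"
    by (intro tendsto_intros)
  then have "Lp_norm r lebesgue (gen_conv f G) \<le> ennreal ((a + 0) * (\<Gamma> + 0))"
    by (rule tendsto_lowerbound) (use scaled in \<open>auto simp: eventually_at_right_less intro: eventually_at_rightI[of 0 1]\<close>)
  then have "Lp_norm r lebesgue (gen_conv f G) \<le> Lp_norm q lebesgue f * ennreal \<Gamma>"
    using a assms(7) by (simp add: ennreal_mult)
  with scaled[of 1] borel_measurable_gen_conv[OF f_meas assms(6)] show ?thesis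
    by simp
qed

end
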